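(* The assignments $\mathbf S\mapsto\mathbb I(\mathbf S)$ (from join-semilattices whose sections are pseudocomplemented lattices to non-classical implication semilattices) and $\mathbf I\mapsto\mathbb S(\mathbf I)$ (from non-classical implication semilattices to join-semilattices whose sections are pseudocomplemented lattices) form a one-to-one correspondence, i.e. $\mathbb S\big(\mathbb I(\mathbf S)\big)=\mathbf S$ for every join-semilattice $\mathbf S$ whose sections are pseudocomplemented lattices, and $\mathbb I\big(\mathbb S(\mathbf I)\big)=\mathbf I$ for every non-classical implication semilattice $\mathbf I$.
   Context: In a join-semilattice $(S,\vee,1)$ with top element $1$, the order is $x\leq y$ iff $x\vee y=y$, and $[x,1]:=\{y\in S: x\leq y\}$ (a section, i.e. principal filter). Throughout, $x\wedge y$ denotes the infimum of $x$ and $y$ in $S$, a partial operation. A pseudocomplemented lattice is a lattice $(L,\vee,\wedge)$ with bottom element $0$ and a unary operation ${}^*$ such that for every $x\in L$, $x^*$ is the greatest $y\in L$ with $x\wedge y=0$. A join-semilattice whose sections are pseudocomplemented lattices is a quintuple $(S,\vee,\wedge,({}^x;x\in S),1)$ where $(S,\vee,1)$ is a join-semilattice with top element $1$, $x\wedge y$ is defined if and only if $x$ and $y$ have a common lower bound, and for every $x\in S$, ${}^x$ is a unary operation on $[x,1]$ such that $([x,1],\vee,\wedge,{}^x)$ is a pseudocomplemented lattice (with bottom element $x$). A non-classical implication semilattice is a quintuple $(S,\vee,\wedge,\rightarrow,1)$ where $(S,\vee,1)$ is a join-semilattice with top element $1$, the infimum $x\wedge y$ exists if and only if $x$ and $y$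 have a common lower bound, and $\rightarrow$ is a binary operation on $S$ such that for all $x,y,z\in S$: (1) $y\leq x\rightarrow y$; (2) $(x\vee y)\wedge(x\rightarrow y)=y$; (3) $(x\vee y)\rightarrow y=x\rightarrow y$; (4) $y\leq(x\vee z)\rightarrow\big((x\vee z)\wedge(y\vee z)\big)$. For a join-semilattice $\mathbf S=(S,\vee,\wedge,({}^x;x\in S),1)$ whose sections are pseudocomplemented lattices, $\mathbb I(\mathbf S):=(S,\vee,\wedge,\rightarrow,1)$ where $x\rightarrow y:=(x\vee y)^y$ for all $x,y\in S$. For a non-classical implication semilattice $\mathbf I=(I,\vee,\wedge,\rightarrow,1)$, $\mathbb S(\mathbf I):=(I,\vee,\wedge,({}^x;x\in I),1)$ where $y^x:=y\rightarrow x$ for all $x\in I$ and $y\in[x,1]$. *)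

theory Defs
  imports "HOL-Algebra.Congruence" "HOL-Library.FuncSet"
begin

text \<open>
  Quintuples are represented by records, and identities between them by record equality. Total
  operations are functions that are extensional on the carrier (arbitrary but fixed outside it), so
  that two records are equal iff the carriers, the constants and the operations on the carriers
  agree. The infimum is a partial operation and has values in an option type.
\<close>

record 'a semilattice_base = "'a partial_object" +
  join :: "'a \<Rightarrow> 'a \<Rightarrow> 'a" (infixl "\<squnion>\<index>" 65)
  meet :: "'a \<Rightarrow> 'a \<Rightarrow> 'a option" (infixl "\<sqinter>\<index>" 70)
  one :: 'a ("\<one>\<index>")

text \<open>\<open>pcomp S x y\<close> is the value $y^x$ of the unary operation of the section $[x,1]$ at $y$.\<close>

record 'a pc_semilattice = "'a semilattice_base" +
  pcomp :: "'a \<Rightarrow> 'a \<Rightarrow> 'a"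

record 'a imp_semilattice = "'a semilattice_base" +
  imp :: "'a \<Rightarrow> 'a \<Rightarrow> 'a" (infixr "\<leadsto>\<index>" 60)

definition le :: "('a, 'b) semilattice_base_scheme \<Rightarrow> 'a \<Rightarrow> 'a \<Rightarrow> bool" (infix "\<sqsubseteq>\<index>" 50)
  where "x \<sqsubseteq>\<^bsub>S\<^esub> y \<longleftrightarrow> x \<squnion>\<^bsub>S\<^esub> y = y"

definition sect :: "('a, 'b) semilattice_base_scheme \<Rightarrow> 'a \<Rightarrow> 'a set"
  where "sect S x = {y \<in> carrier S. x \<sqsubseteq>\<^bsub>S\<^esub> y}"

definition is_infimum :: "('a, 'b) semilattice_base_scheme \<Rightarrow> 'a \<Rightarrow> 'a \<Rightarrow> 'a \<Rightarrow> bool"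
  where "is_infimum S x y z \<longleftrightarrow>
    z \<in> carrier S \<and> z \<sqsubseteq>\<^bsub>S\<^esub> x \<and> z \<sqsubseteq>\<^bsub>S\<^esub> y \<and>
    (\<forall>w \<in> carrier S. w \<sqsubseteq>\<^bsub>S\<^esub> x \<and> w \<sqsubseteq>\<^bsub>S\<^esub> y \<longrightarrow> w \<sqsubseteq>\<^bsub>S\<^esub> z)"

locale join_semilattice_with_top =
  fixes S :: "('a, 'b) semilattice_base_scheme" (structure)
  assumes join_ext: "join S \<in> carrier S \<rightarrow>\<^sub>E carrier S \<rightarrow>\<^sub>E carrier S"
    and join_assoc: "\<lbrakk>x \<in> carrier S; y \<in> carrier S; z \<in> carrier S\<rbrakk>
      \<Longrightarrow> (x \<squnion> y) \<squnion> z = x \<squnion> (y \<squnion> z)"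
    and join_comm: "\<lbrakk>x \<in> carrier S; y \<in> carrier S\<rbrakk> \<Longrightarrow> x \<squnion> y = y \<squnion> x"
    and join_idem: "x \<in> carrier S \<Longrightarrow> x \<squnion> x = x"
    and one_closed: "\<one> \<in> carrier S"
    and one_top: "x \<in> carrier S \<Longrightarrow> x \<sqsubseteq> \<one>"

locale join_semilattice_with_partial_meet = join_semilattice_with_top +
  assumes meet_ext: "meet S \<in> carrier S \<rightarrow>\<^sub>E carrier S \<rightarrow>\<^sub>E UNIV"
    and meet_infimum: "\<lbrakk>x \<in> carrier S; y \<in> carrier S\<rbrakk>
      \<Longrightarrow> x \<sqinter> y = Some z \<longleftrightarrow> is_infimum S x y z"
    and meet_defined_iff: "\<lbrakk>x \<in> carrier S; y \<in> carrier S\<rbrakk>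
      \<Longrightarrow> x \<sqinter> y \<noteq> None \<longleftrightarrow> (\<exists>z \<in> carrier S. z \<sqsubseteq> x \<and> z \<sqsubseteq> y)"

locale pseudocomplemented_lattice =
  fixes L :: "'a set"
    and jn :: "'a \<Rightarrow> 'a \<Rightarrow> 'a" (infixl "\<curlyvee>" 65)
    and mt :: "'a \<Rightarrow> 'a \<Rightarrow> 'a" (infixl "\<curlywedge>" 70)
    and bot :: 'a
    and pc :: "'a \<Rightarrow> 'a"
  assumes jn_closed: "\<lbrakk>x \<in> L; y \<in> L\<rbrakk> \<Longrightarrow> x \<curlyvee> y \<in> L"
    and mt_closed: "\<lbrakk>x \<in> L; y \<in> L\<rbrakk> \<Longrightarrow> x \<curlywedge> y \<in> L"
    and jn_assoc: "\<lbrakk>x \<in> L; y \<in> L; z \<in> L\<rbrakk> \<Longrightarrow> (x \<curlyvee> y) \<curlyvee> z = x \<curlyvee> (y \<curlyvee> z)"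
    and mt_assoc: "\<lbrakk>x \<in> L; y \<in> L; z \<in> L\<rbrakk> \<Longrightarrow> (x \<curlywedge> y) \<curlywedge> z = x \<curlywedge> (y \<curlywedge> z)"
    and jn_comm: "\<lbrakk>x \<in> L; y \<in> L\<rbrakk> \<Longrightarrow> x \<curlyvee> y = y \<curlyvee> x"
    and mt_comm: "\<lbrakk>x \<in> L; y \<in> L\<rbrakk> \<Longrightarrow> x \<curlywedge> y = y \<curlywedge> x"
    and jn_absorb: "\<lbrakk>x \<in> L; y \<in> L\<rbrakk> \<Longrightarrow> x \<curlyvee> (x \<curlywedge> y) = x"
    and mt_absorb: "\<lbrakk>x \<in> L; y \<in> L\<rbrakk> \<Longrightarrow> x \<curlywedge> (x \<curlyvee> y) = x"
    and bot_closed: "bot \<in> L"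
    and bot_least: "x \<in> L \<Longrightarrow> bot \<curlyvee> x = x"
    and pc_closed: "x \<in> L \<Longrightarrow> pc x \<in> L"
    and mt_pc: "x \<in> L \<Longrightarrow> x \<curlywedge> pc x = bot"
    and pc_greatest: "\<lbrakk>x \<in> L; y \<in> L; x \<curlywedge> y = bot\<rbrakk> \<Longrightarrow> y \<curlyvee> pc x = pc x"

text \<open>
  Two elements of a section $[x,1]$ have the common lower bound $x$, so their infimum is defined
  and the use of \<open>the\<close> below is harmless; the same applies to the last axiom for \<open>\<leadsto>\<close>, where
  $z$ is a common lower bound.
\<close>

locale semilattice_with_pseudocomplemented_sections =
  join_semilattice_with_partial_meet S for S :: "'a pc_semilattice" (structure) +
  assumes pcomp_ext: "pcomp S \<in> (\<Pi>\<^sub>E x \<in> carrier S. sect S x \<rightarrow>\<^sub>E sect S x)"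
    and sect_pseudocomplemented: "x \<in> carrier S \<Longrightarrow>
      pseudocomplemented_lattice (sect S x) (\<lambda>a b. a \<squnion> b) (\<lambda>a b. the (a \<sqinter> b)) x (pcomp S x)"

locale nonclassical_implication_semilattice =
  join_semilattice_with_partial_meet I for I :: "'a imp_semilattice" (structure) +
  assumes imp_ext: "imp I \<in> carrier I \<rightarrow>\<^sub>E carrier I \<rightarrow>\<^sub>E carrier I"
    and imp1: "\<lbrakk>x \<in> carrier I; y \<in> carrier I\<rbrakk> \<Longrightarrow> y \<sqsubseteq> x \<leadsto> y"
    and imp2: "\<lbrakk>x \<in> carrier I; y \<in> carrier I\<rbrakk> \<Longrightarrow> (x \<squnion> y) \<sqinter> (x \<leadsto> y) = Some y"
    and imp3: "\<lbrakk>x \<in> carrier I; y \<in> carrier I\<rbrakk> \<Longrightarrow> (x \<squnion> y) \<leadsto> y = x \<leadsto> y"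
    and imp4: "\<lbrakk>x \<in> carrier I; y \<in> carrier I; z \<in> carrier I\<rbrakk>
      \<Longrightarrow> y \<sqsubseteq> (x \<squnion> z) \<leadsto> the ((x \<squnion> z) \<sqinter> (y \<squnion> z))"

definition imp_of_pc :: "'a pc_semilattice \<Rightarrow> 'a imp_semilattice" ("\<I>")
  where "\<I> S = \<lparr>carrier = carrier S, join = join S, meet = meet S, one = \<one>\<^bsub>S\<^esub>,
    imp = (\<lambda>x \<in> carrier S. \<lambda>y \<in> carrier S. pcomp S y (x \<squnion>\<^bsub>S\<^esub> y))\<rparr>"

definition pc_of_imp :: "'a imp_semilattice \<Rightarrow> 'a pc_semilattice" ("\<S>")
  where "\<S> I = \<lparr>carrier = carrier I, join = join I, meet = meet I, one = \<one>\<^bsub>I\<^esub>,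
    pcomp = (\<lambda>x \<in> carrier I. \<lambda>y \<in> sect I x. y \<leadsto>\<^bsub>I\<^esub> x)\<rparr>"

end

theory Submission
  imports Defs
begin

text \<open>
  The only substantial point is that axiom (4) for \<open>\<leadsto>\<close> is the maximality of pseudocomplements. If
  $m = (x \vee z) \wedge (y \vee z)$, then $y \vee z$ meets $x \vee z$ in the bottom $m$ of the section
  $[m,1]$, so $y \leq y \vee z \leq (x \vee z)^m$. Conversely, if $a$ and $b$ lie in $[x,1]$ and
  $a \wedge b = x$, then (4) for $a$, $b$, $x$ reads $b \leq a \rightarrow x$.
\<close>

text \<open>The locale speaks only of the four base fields, so it passes between records of
  different types that agree on them, such as \<open>S\<close> and \<open>\<I> S\<close>.\<close>

lemma join_semilattice_with_partial_meet_transfer: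
  assumes "join_semilattice_with_partial_meet S"
    and "carrier T = carrier S" "join T = join S" "meet T = meet S" "one T = one S"
  shows "join_semilattice_with_partial_meet T"
  using assms(1)
  unfolding join_semilattice_with_partial_meet_def join_semilattice_with_partial_meet_axioms_def
    join_semilattice_with_top_def is_infimum_def le_def assms(2-5) .

section \<open>Order and infima in a join-semilattice\<close>

context join_semilattice_with_top
begin

lemma join_closed: "\<lbrakk>x \<in> carrier S; y \<in> carrier S\<rbrakk> \<Longrightarrow> x \<squnion> y \<in> carrier S"
  using join_ext by (auto simp: PiE_iff)

lemma le_refl: "x \<in> carrier S \<Longrightarrow> x \<sqsubseteq> x"
  by (simp add: le_def join_idem)

lemma le_antisym: "\<lbrakk>x \<in> carrier S; y \<in> carrier S; x \<sqsubseteq> y; y \<sqsubseteq> x\<rbrakk> \<Longrightarrow> x = y"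
  by (simp add: le_def join_comm[of x y])

lemma le_trans:
  "\<lbrakk>x \<in> carrier S; y \<in> carrier S; z \<in> carrier S; x \<sqsubseteq> y; y \<sqsubseteq> z\<rbrakk> \<Longrightarrow> x \<sqsubseteq> z"
  unfolding le_def by (metis join_assoc)

lemma le_join1: "\<lbrakk>x \<in> carrier S; y \<in> carrier S\<rbrakk> \<Longrightarrow> x \<sqsubseteq> x \<squnion> y"
  by (simp add: le_def join_idem flip: join_assoc)

lemma le_join2: "\<lbrakk>x \<in> carrier S; y \<in> carrier S\<rbrakk> \<Longrightarrow> y \<sqsubseteq> x \<squnion> y"
  using le_join1[of y x] by (simp add: join_comm)

lemma join_absorb2: "\<lbrakk>x \<in> carrier S; y \<in> carrier S; y \<sqsubseteq> x\<rbrakk> \<Longrightarrow> x \<squnion> y = x"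
  by (simp add: le_def join_comm[of x y])

lemma is_infimum_unique: "is_infimum S x y z \<Longrightarrow> is_infimum S x y w \<Longrightarrow> z = w"
  unfolding is_infimum_def using le_antisym by blast

lemma is_infimum_commute: "is_infimum S x y z \<Longrightarrow> is_infimum S y x z"
  unfolding is_infimum_def by blast

lemma is_infimum_absorb:
  "\<lbrakk>x \<in> carrier S; x \<sqsubseteq> y\<rbrakk> \<Longrightarrow> is_infimum S x y x"
  unfolding is_infimum_def using le_refl by blast

text \<open>Both bracketings describe the greatest lower bound of \<open>x\<close>,
  \<open>y\<close>, \<open>z\<close>. Working with the relation instead of the partial operation
  keeps definedness out of the argument.\<close>

lemma is_infimum_assoc:
  assumes "x \<in> carrier S" "y \<in> carrier S" "z \<in> carrier S"
    and "is_infimum S x y u" "is_infimum S y z v" "is_infimum S u z w"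
  shows "is_infimum S x v w"
proof -
  have u: "u \<in> carrier S" "u \<sqsubseteq> x" "u \<sqsubseteq> y"
    and u_greatest: "\<And>t. \<lbrakk>t \<in> carrier S; t \<sqsubseteq> x; t \<sqsubseteq> y\<rbrakk> \<Longrightarrow> t \<sqsubseteq> u"
    using assms(4) by (auto simp: is_infimum_def)
  have v: "v \<in> carrier S" "v \<sqsubseteq> y" "v \<sqsubseteq> z"
    and v_greatest: "\<And>t. \<lbrakk>t \<in> carrier S; t \<sqsubseteq> y; t \<sqsubseteq> z\<rbrakk> \<Longrightarrow> t \<sqsubseteq> v"
    using assms(5) by (auto simp: is_infimum_def)
  have w: "w \<in> carrier S" "w \<sqsubseteq> u" "w \<sqsubseteq> z"
    and w_greatest: "\<And>t. \<lbrakk>t \<in> carrier S; t \<sqsubseteq> u; t \<sqsubseteq> z\<rbrakk> \<Longrightarrow> t \<sqsubseteq> w"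
    using assms(6) by (auto simp: is_infimum_def)
  have "w \<sqsubseteq> x" "w \<sqsubseteq> v"
    using le_trans[of w u x] le_trans[of w u y] v_greatest u w assms(1,2) by auto
  moreover have "t \<sqsubseteq> w" if "t \<in> carrier S" "t \<sqsubseteq> x" "t \<sqsubseteq> v" for t
    using that le_trans[of t v y] le_trans[of t v z] u_greatest w_greatest v assms(2,3) by auto
  ultimately show ?thesis
    using w(1) by (auto simp: is_infimum_def)
qed

end

section \<open>Sections as lattices\<close>

context join_semilattice_with_partial_meet
begin

text \<open>The bottom \<open>x\<close> of the section is the common lower bound that makes the meet
  defined.\<close>

lemma is_infimum_the_meet:
  assumes "x \<in> carrier S" "a \<in> sect S x" "b \<in> sect S x"
  shows "is_infimum S a b (the (a \<sqinter> b))"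
proof -
  have ab: "a \<in> carrier S" "b \<in> carrier S" and "x \<sqsubseteq> a" "x \<sqsubseteq> b"
    using assms by (auto simp: sect_def)
  then have "a \<sqinter> b \<noteq> None"
    using meet_defined_iff assms(1) by blast
  then have "a \<sqinter> b = Some (the (a \<sqinter> b))"
    by simp
  then show ?thesis
    by (rule meet_infimum[OF ab, THEN iffD1])
qed

text \<open>Reduces each lattice law for \<open>the (a \<sqinter> b)\<close> to exhibiting an
  infimum.\<close>

lemma the_meet_eq:
  assumes "x \<in> carrier S" "a \<in> sect S x" "b \<in> sect S x" "is_infimum S a b c"
  shows "the (a \<sqinter> b) = c"
  using is_infimum_the_meet is_infimum_unique assms by blast

lemma the_meet_in_sect:
  assumes "x \<in> carrier S" "a \<in> sect S x" "b \<in> sect S x"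
  shows "the (a \<sqinter> b) \<in> sect S x"
  using is_infimum_the_meet[OF assms] assms unfolding is_infimum_def sect_def by blast

text \<open>Every section is already a lattice with bottom \<open>x\<close>: the infimum of two of
  its elements exists and again lies above \<open>x\<close>. Hence only three properties of the
  candidate \<open>p\<close> have to be supplied.\<close>

lemma pseudocomplemented_lattice_sectI:
  assumes x: "x \<in> carrier S"
    and closed: "\<And>a. a \<in> sect S x \<Longrightarrow> p a \<in> sect S x"
    and meet: "\<And>a. a \<in> sect S x \<Longrightarrow> a \<sqinter> p a = Some x"
    and greatest: "\<And>a b. \<lbrakk>a \<in> sect S x; b \<in> sect S x; the (a \<sqinter> b) = x\<rbrakk> \<Longrightarrow> b \<sqsubseteq> p a"
  shows "pseudocomplemented_lattice (sect S x) (\<lambda>a b. a \<squnion> b) (\<lambda>a b. the (a \<sqinter> b)) x p"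
proof -
  note inf = is_infimum_the_meet[OF x] and meet_sect = the_meet_in_sect[OF x]
    and meet_eq = the_meet_eq[OF x]
  have car: "a \<in> carrier S" if "a \<in> sect S x" for a
    using that by (simp add: sect_def)
  have jn: "a \<squnion> b \<in> sect S x" if "a \<in> sect S x" "b \<in> sect S x" for a b
    using that x le_trans[of x a "a \<squnion> b"] by (auto simp: sect_def join_closed le_join1)
  show ?thesis
  proof (rule pseudocomplemented_lattice.intro)
    fix a b c
    assume abc: "a \<in> sect S x" "b \<in> sect S x" "c \<in> sect S x"
    have "is_infimum S a (the (b \<sqinter> c)) (the (the (a \<sqinter> b) \<sqinter> c))"
      using abc by (intro is_infimum_assoc[OF car car car inf inf inf] meet_sect)
    then show "the (the (a \<sqinter> b) \<sqinter> c) = the (a \<sqinter> the (b \<sqinter> c))"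
      using abc by (intro meet_eq[symmetric] meet_sect)
  next
    fix a b
    assume ab: "a \<in> sect S x" "b \<in> sect S x"
    show "the (a \<sqinter> b) = the (b \<sqinter> a)"
      using ab by (intro meet_eq is_infimum_commute[OF inf])
    show "a \<squnion> the (a \<sqinter> b) = a"
      using ab inf[OF ab] by (intro join_absorb2 car meet_sect) (auto simp: is_infimum_def)
    show "the (a \<sqinter> (a \<squnion> b)) = a"
      using ab by (intro meet_eq is_infimum_absorb jn le_join1 car)
    show "a \<squnion> b = b \<squnion> a"
      using ab by (intro join_comm car)
    show "b \<squnion> p a = p a" if "the (a \<sqinter> b) = x"
      using greatest[OF ab that] by (simp add: le_def)
  next
    fix a b c
    assume "a \<in> sect S x" "b \<in> sect S x" "c \<in> sect S x"
    then show "(a \<squnion> b) \<squnion> c = a \<squnion> (b \<squnion> c)"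
      by (intro join_assoc car)
  next
    fix a
    assume "a \<in> sect S x"
    then show "x \<squnion> a = a" "the (a \<sqinter> p a) = x"
      by (simp_all add: sect_def le_def meet)
  next
    show "x \<in> sect S x"
      using x by (simp add: sect_def le_refl)
  qed (simp_all add: jn meet_sect closed)
qed

end

section \<open>From pseudocomplements to implication\<close>

context semilattice_with_pseudocomplemented_sections
begin

lemma pcomp_in_sect: "\<lbrakk>x \<in> carrier S; a \<in> sect S x\<rbrakk> \<Longrightarrow> pcomp S x a \<in> sect S x"
  using sect_pseudocomplemented by (rule pseudocomplemented_lattice.pc_closed)

text \<open>The lattice law only determines \<open>the\<close> of the meet. Since infima exist in
  the section, the meet is really defined, which is the form that axiom (2) requires.\<close>

lemma meet_pcomp:
  assumes "x \<in> carrier S" "a \<in> sect S x"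
  shows "a \<sqinter> pcomp S x a = Some x"
proof -
  have "the (a \<sqinter> pcomp S x a) = x"
    using sect_pseudocomplemented[OF assms(1)] assms(2)
    by (rule pseudocomplemented_lattice.mt_pc)
  then have "is_infimum S a (pcomp S x a) x"
    using is_infimum_the_meet[OF assms pcomp_in_sect[OF assms]] by simp
  then show ?thesis
    using assms pcomp_in_sect[OF assms] by (subst meet_infimum) (auto simp: sect_def)
qed

lemma le_pcomp:
  "\<lbrakk>x \<in> carrier S; a \<in> sect S x; b \<in> sect S x; the (a \<sqinter> b) = x\<rbrakk> \<Longrightarrow> b \<sqsubseteq> pcomp S x a"
  using pseudocomplemented_lattice.pc_greatest[OF sect_pseudocomplemented] by (simp add: le_def)

lemma join_in_sect: "\<lbrakk>x \<in> carrier S; y \<in> carrier S\<rbrakk> \<Longrightarrow> x \<squnion> y \<in> sect S y"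
  by (simp add: sect_def join_closed le_join2)

text \<open>This is axiom (4) with the implication of \<open>\<I> S\<close> unfolded, which explains
  the extra join with \<open>m\<close>. Membership of \<open>m\<close> in the carrier is recorded
  because the implication is given by its formula only there.\<close>

lemma le_pcomp_meet:
  assumes "x \<in> carrier S" "y \<in> carrier S" "z \<in> carrier S"
  defines "m \<equiv> the ((x \<squnion> z) \<sqinter> (y \<squnion> z))"
  shows "m \<in> carrier S" "y \<sqsubseteq> pcomp S m ((x \<squnion> z) \<squnion> m)"
proof -
  have inf: "is_infimum S (x \<squnion> z) (y \<squnion> z) m"
    unfolding m_def using assms by (intro is_infimum_the_meet[of z] join_in_sect)
  then show m: "m \<in> carrier S"
    by (simp add: is_infimum_def)
  have xz: "x \<squnion> z \<in> sect S m" and yz: "y \<squnion> z \<in> sect S m"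
    using inf assms by (auto simp: sect_def is_infimum_def join_closed)
  have p: "pcomp S m (x \<squnion> z) \<in> carrier S"
    using pcomp_in_sect[OF m xz] by (simp add: sect_def)
  have "y \<squnion> z \<sqsubseteq> pcomp S m (x \<squnion> z)"
    using le_pcomp[OF m xz yz] by (simp add: m_def)
  then have "y \<sqsubseteq> pcomp S m (x \<squnion> z)"
    using le_trans[OF _ _ p, of y "y \<squnion> z"] assms by (simp add: join_closed le_join1)
  moreover have "(x \<squnion> z) \<squnion> m = x \<squnion> z"
    using xz m by (intro join_absorb2) (auto simp: sect_def)
  ultimately show "y \<sqsubseteq> pcomp S m ((x \<squnion> z) \<squnion> m)"
    by simp
qed

text \<open>Axioms (1) and (2) hold because the pseudocomplement of \<open>x \<squnion> y\<close>
  lies in the section of \<open>y\<close> and meets \<open>x \<squnion> y\<close> in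
  \<open>y\<close>. Axiom (3) is
  \<open>(x \<squnion> y) \<squnion> y = x \<squnion> y\<close>.\<close>

lemma nonclassical_implication_semilattice_imp_of_pc:
  "nonclassical_implication_semilattice (\<I> S)"
proof -
  have le [simp]: "le (\<I> S) = le S"
    by (simp add: imp_of_pc_def le_def fun_eq_iff)
  have sel [simp]: "carrier (\<I> S) = carrier S" "join (\<I> S) = join S" "meet (\<I> S) = meet S"
    by (simp_all add: imp_of_pc_def)
  have imp: "imp (\<I> S) = (\<lambda>x \<in> carrier S. \<lambda>y \<in> carrier S. pcomp S y (x \<squnion> y))"
    by (simp add: imp_of_pc_def)
  interpret I: join_semilattice_with_partial_meet "\<I> S"
    using join_semilattice_with_partial_meet_axioms
    by (rule join_semilattice_with_partial_meet_transfer) (simp_all add: imp_of_pc_def)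
  have p: "pcomp S y (x \<squnion> y) \<in> sect S y" if "x \<in> carrier S" "y \<in> carrier S" for x y
    using that by (intro pcomp_in_sect join_in_sect)
  show ?thesis
  proof
    show "imp (\<I> S) \<in> carrier (\<I> S) \<rightarrow>\<^sub>E carrier (\<I> S) \<rightarrow>\<^sub>E carrier (\<I> S)"
      using p by (auto simp: imp sect_def)
  next
    fix x y
    assume "x \<in> carrier (\<I> S)" "y \<in> carrier (\<I> S)"
    then have xy: "x \<in> carrier S" "y \<in> carrier S"
      by simp_all
    show "y \<sqsubseteq>\<^bsub>\<I> S\<^esub> x \<leadsto>\<^bsub>\<I> S\<^esub> y"
      using p[OF xy] xy by (simp add: imp sect_def)
    show "(x \<squnion>\<^bsub>\<I> S\<^esub> y) \<sqinter>\<^bsub>\<I> S\<^esub> (x \<leadsto>\<^bsub>\<I> S\<^esub> y) = Some y"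
      using meet_pcomp[OF xy(2) join_in_sect[OF xy]] xy by (simp add: imp)
    show "(x \<squnion>\<^bsub>\<I> S\<^esub> y) \<leadsto>\<^bsub>\<I> S\<^esub> y = x \<leadsto>\<^bsub>\<I> S\<^esub> y"
      using xy by (simp add: imp join_closed join_assoc join_idem)
    fix z
    assume "z \<in> carrier (\<I> S)"
    then show "y \<sqsubseteq>\<^bsub>\<I> S\<^esub> (x \<squnion>\<^bsub>\<I> S\<^esub> z) \<leadsto>\<^bsub>\<I> S\<^esub>
        the ((x \<squnion>\<^bsub>\<I> S\<^esub> z) \<sqinter>\<^bsub>\<I> S\<^esub> (y \<squnion>\<^bsub>\<I> S\<^esub> z))"
      using le_pcomp_meet[of x y z] xy by (simp add: imp join_closed)
  qed
qed

text \<open>For \<open>y\<close> in the section of \<open>x\<close> the round trip gives the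
  pseudocomplement of \<open>y \<squnion> x\<close>, and \<open>y \<squnion> x = y\<close>. Equality
  of records also requires agreement outside the sections, which extensionality provides.\<close>

lemma pc_of_imp_of_pc: "\<S> (\<I> S) = S"
proof -
  have "pcomp (\<S> (\<I> S)) x y = pcomp S x y" for x y
  proof (cases "x \<in> carrier S")
    case x: True
    show ?thesis
    proof (cases "y \<in> sect S x")
      case True
      then have "y \<in> carrier S" "y \<squnion> x = y"
        using x by (auto simp: sect_def join_absorb2)
      then show ?thesis
        using x True by (simp add: pc_of_imp_def imp_of_pc_def sect_def le_def)
    next
      case False
      have "pcomp S x y = undefined"
        using x False pcomp_ext by (auto simp: PiE_iff extensional_def)
      with x False show ?thesis
        by (auto simp: pc_of_imp_def imp_of_pc_def sect_def le_def)
    qed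
  next
    \<comment> \<open>Here the value at \<open>x\<close> is the default function
      \<open>undefined\<close> on both sides, so they agree at every \<open>y\<close>.\<close>
    case False
    then show ?thesis
      using pcomp_ext by (simp add: pc_of_imp_def imp_of_pc_def PiE_iff extensional_def)
  qed
  then have "pcomp (\<S> (\<I> S)) = pcomp S"
    by blast
  then show ?thesis
    by (simp add: pc_of_imp_def imp_of_pc_def)
qed

end

section \<open>From implication to pseudocomplements\<close>

context nonclassical_implication_semilattice
begin

lemma imp_closed: "\<lbrakk>x \<in> carrier I; y \<in> carrier I\<rbrakk> \<Longrightarrow> x \<leadsto> y \<in> carrier I"
  using imp_ext by (auto simp: PiE_iff)

text \<open>Axiom (1) keeps \<open>p\<close> inside the section, (2) makes it a complement and (4)
  makes it the greatest one. The function \<open>p\<close> is fixed only on the section because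
  \<open>pcomp (\<S> I) x\<close> is a restricted function.\<close>

lemma pseudocomplemented_lattice_sect_imp:
  assumes x: "x \<in> carrier I" and p: "\<And>y. y \<in> sect I x \<Longrightarrow> p y = y \<leadsto> x"
  shows "pseudocomplemented_lattice (sect I x) (\<lambda>a b. a \<squnion> b) (\<lambda>a b. the (a \<sqinter> b)) x p"
proof -
  \<comment> \<open>Joining with the bottom \<open>x\<close> changes nothing in its section, so the
    joins in (2) and (4) disappear.\<close>
  have eq: "a \<in> carrier I" "a \<squnion> x = a" if "a \<in> sect I x" for a
    using that x by (auto simp: sect_def join_absorb2)
  show ?thesis
  proof (rule pseudocomplemented_lattice_sectI[OF x])
    fix a assume a: "a \<in> sect I x"
    show "p a \<in> sect I x"
      using x eq(1)[OF a] unfolding p[OF a] by (simp add: imp_closed imp1 sect_def)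
    show "a \<sqinter> p a = Some x"
      using imp2[OF eq(1)[OF a] x] by (simp add: p[OF a] eq(2)[OF a])
    fix b assume b: "b \<in> sect I x" and "the (a \<sqinter> b) = x"
    then show "b \<sqsubseteq> p a"
      using imp4[OF eq(1)[OF a] eq(1)[OF b] x] by (simp add: p[OF a] eq(2)[OF a] eq(2)[OF b])
  qed
qed

lemma semilattice_with_pseudocomplemented_sections_pc_of_imp:
  "semilattice_with_pseudocomplemented_sections (\<S> I)"
proof -
  have sect [simp]: "sect (\<S> I) = sect I"
    by (simp add: pc_of_imp_def sect_def le_def fun_eq_iff)
  have sel [simp]: "carrier (\<S> I) = carrier I" "join (\<S> I) = join I" "meet (\<S> I) = meet I"
    by (simp_all add: pc_of_imp_def)
  have pcomp: "pcomp (\<S> I) = (\<lambda>x \<in> carrier I. \<lambda>y \<in> sect I x. y \<leadsto> x)"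
    by (simp add: pc_of_imp_def)
  have "join_semilattice_with_partial_meet (\<S> I)"
    using join_semilattice_with_partial_meet_axioms
    by (rule join_semilattice_with_partial_meet_transfer) (simp_all add: pc_of_imp_def)
  then show ?thesis
  proof (intro semilattice_with_pseudocomplemented_sections.intro
      semilattice_with_pseudocomplemented_sections_axioms.intro)
    show "pcomp (\<S> I) \<in> (\<Pi>\<^sub>E x \<in> carrier (\<S> I). sect (\<S> I) x \<rightarrow>\<^sub>E sect (\<S> I) x)"
      by (auto simp: pcomp) (auto simp: sect_def imp_closed imp1)
  next
    fix x assume "x \<in> carrier (\<S> I)"
    then show "pseudocomplemented_lattice (sect (\<S> I) x) (\<lambda>a b. a \<squnion>\<^bsub>\<S> I\<^esub> b)
        (\<lambda>a b. the (a \<sqinter>\<^bsub>\<S> I\<^esub> b)) x (pcomp (\<S> I) x)"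
      using pseudocomplemented_lattice_sect_imp[of x "pcomp (\<S> I) x"] by (simp add: pcomp)
  qed
qed

text \<open>The round trip replaces \<open>x \<leadsto> y\<close> by
  \<open>(x \<squnion> y) \<leadsto> y\<close>, and axiom (3) undoes this. Off the carrier both
  sides take the default value.\<close>

lemma imp_of_pc_of_imp: "\<I> (\<S> I) = I"
proof -
  have "imp (\<I> (\<S> I)) x y = x \<leadsto> y" for x y
  proof (cases "x \<in> carrier I \<and> y \<in> carrier I")
    case True
    then have "x \<squnion> y \<in> sect I y"
      by (simp add: sect_def join_closed le_join2)
    then show ?thesis
      using True by (simp add: pc_of_imp_def imp_of_pc_def imp3)
  next
    case False
    then show ?thesis
      using imp_ext
      by (cases "x \<in> carrier I") (simp_all add: pc_of_imp_def imp_of_pc_def PiE_iff extensional_def)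
  qed
  then have "imp (\<I> (\<S> I)) = imp I"
    by blast
  then show ?thesis
    by (simp add: pc_of_imp_def imp_of_pc_def)
qed

end

theorem theorem3p7:
  shows "(\<forall>S :: 'a pc_semilattice. semilattice_with_pseudocomplemented_sections S \<longrightarrow>
            nonclassical_implication_semilattice (\<I> S) \<and> \<S> (\<I> S) = S) \<and>
         (\<forall>I :: 'a imp_semilattice. nonclassical_implication_semilattice I \<longrightarrow>
            semilattice_with_pseudocomplemented_sections (\<S> I) \<and> \<I> (\<S> I) = I)"
  using
    semilattice_with_pseudocomplemented_sections.nonclassical_implication_semilattice_imp_of_pc
    semilattice_with_pseudocomplemented_sections.pc_of_imp_of_pc
    nonclassical_implication_semilattice.semilattice_with_pseudocomplemented_sections_pc_of_imp
    nonclassical_implication_semilattice.imp_of_pc_of_imp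
  by blast

end
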